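(* There exists a positive constant $D$ such that for every integer $N \ge 7$, $$B(N,3,=) \ge \left \lfloor \frac{3N}{10}\right \rfloor - D.$$
   Context: There are $N$ balls $b_1,\dots,b_N$, each colored red or green, with strictly fewer green than red balls (a Red-green coloring). For an integer $0\le p<\frac N2$, the coloring is $p$-equal if exactly $p$ balls are green. A comparison consists of choosing two balls and being told whether or not they have the same color (only "same" or "different" is answered). A method is an adaptive deterministic strategy: each comparison may depend on the answers to the previous ones. $Q(N,p,=)$ is the minimum integer $k$ such that there exists a method which, for every $p$-equal Red-green coloring of the $N$ balls (it being known in advance that the coloring is $p$-equal), determines for sure the color of every ball after at most $k$ comparisons. One sets $B(N,p,=) := N - Q(N,p,=)$. *)

theory Defs
  imports Complex_Main
begin

datatype color = Red | Green

text \<open>The balls are the natural numbers below \<open>N\<close>; only the values of a coloring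
  on these numbers are ever used.\<close>

type_synonym coloring = "nat \<Rightarrow> color"

definition red_green_coloring :: "nat \<Rightarrow> coloring \<Rightarrow> bool" where
  "red_green_coloring N c \<longleftrightarrow> card {i. i < N \<and> c i = Green} < card {i. i < N \<and> c i = Red}"

definition p_equal :: "nat \<Rightarrow> nat \<Rightarrow> coloring \<Rightarrow> bool" where
  "p_equal N p c \<longleftrightarrow> red_green_coloring N c \<and> card {i. i < N \<and> c i = Green} = p"

text \<open>An adaptive deterministic method is a decision tree. \<open>Compare i j s d\<close> compares
  the balls \<open>i\<close> and \<open>j\<close> and continues with \<open>s\<close> on the answer ``same'' and
  with \<open>d\<close> on the answer ``different''; \<open>Announce c\<close> stops and announces the
  coloring \<open>c\<close>.\<close>

datatype strategy = Announce coloring | Compare nat nat strategy strategy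

primrec valid_strategy :: "nat \<Rightarrow> strategy \<Rightarrow> bool" where
  "valid_strategy N (Announce c) \<longleftrightarrow> True"
| "valid_strategy N (Compare i j s d) \<longleftrightarrow>
     i < N \<and> j < N \<and> i \<noteq> j \<and> valid_strategy N s \<and> valid_strategy N d"

primrec announced :: "strategy \<Rightarrow> coloring \<Rightarrow> coloring" where
  "announced (Announce c') c = c'"
| "announced (Compare i j s d) c = (if c i = c j then announced s c else announced d c)"

primrec comparisons :: "strategy \<Rightarrow> coloring \<Rightarrow> nat" where
  "comparisons (Announce c') c = 0"
| "comparisons (Compare i j s d) c = Suc (if c i = c j then comparisons s c else comparisons d c)"

definition solves_within :: "nat \<Rightarrow> nat \<Rightarrow> nat \<Rightarrow> strategy \<Rightarrow> bool" where
  "solves_within N p k t \<longleftrightarrow> valid_strategy N t \<and>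
     (\<forall>c. p_equal N p c \<longrightarrow> (\<forall>i<N. announced t c i = c i) \<and> comparisons t c \<le> k)"

text \<open>\<open>Q_eq N p\<close> and \<open>B_eq N p\<close> stand for \<open>Q(N,p,=)\<close> and
  \<open>B(N,p,=)\<close>. They are meaningful for \<open>2 * p < N\<close>; otherwise no coloring is
  \<open>p\<close>-equal. The set minimized over is nonempty by \<open>solves_within_exists\<close>.\<close>

definition Q_eq :: "nat \<Rightarrow> nat \<Rightarrow> nat" where
  "Q_eq N p = (LEAST k. \<exists>t. solves_within N p k t)"

definition B_eq :: "nat \<Rightarrow> nat \<Rightarrow> int" where
  "B_eq N p = int N - int (Q_eq N p)"

text \<open>Existence: compare every ball with ball \<open>0\<close>; the majority color is red.\<close>

primrec compare_all :: "nat \<Rightarrow> (nat set \<Rightarrow> coloring) \<Rightarrow> nat set \<Rightarrow> strategy" where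
  "compare_all 0 f S = Announce (f S)"
| "compare_all (Suc n) f S =
     Compare 0 (Suc n) (compare_all n f (insert (Suc n) S)) (compare_all n f S)"

lemma valid_compare_all: "n < N \<Longrightarrow> valid_strategy N (compare_all n f S)"
  by (induction n arbitrary: S) auto

lemma comparisons_compare_all: "comparisons (compare_all n f S) c = n"
  by (induction n arbitrary: S) auto

lemma announced_compare_all:
  "announced (compare_all n f S) c = f (S \<union> {i. 1 \<le> i \<and> i \<le> n \<and> c i = c 0})"
proof (induction n arbitrary: S)
  case 0
  have "{i. 1 \<le> i \<and> i \<le> (0::nat) \<and> c i = c 0} = {}" by auto
  then show ?case by (simp only: compare_all.simps announced.simps Un_empty_right)
next
  case (Suc n)
  have "{i. 1 \<le> i \<and> i \<le> Suc n \<and> c i = c 0} =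
    (if c 0 = c (Suc n) then insert (Suc n) {i. 1 \<le> i \<and> i \<le> n \<and> c i = c 0}
     else {i. 1 \<le> i \<and> i \<le> n \<and> c i = c 0})"
    by (auto simp: le_Suc_eq)
  then show ?case using Suc by simp
qed

lemma p_equal_determined:
  assumes c: "p_equal N p c" and d: "p_equal N p d" and N: "N > 0"
    and same: "{i. 1 \<le> i \<and> i \<le> N - 1 \<and> c i = c 0} = {i. 1 \<le> i \<and> i \<le> N - 1 \<and> d i = d 0}"
    and i: "i < N"
  shows "c i = d i"
proof -
  have eq: "c j = c 0 \<longleftrightarrow> d j = d 0" if "j < N" for j
  proof (cases "j = 0")
    case False
    with that N have "1 \<le> j \<and> j \<le> N - 1" by auto
    with same show ?thesis by blast
  qed simp
  have "c 0 = d 0"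
  proof (rule ccontr)
    assume ne: "c 0 \<noteq> d 0"
    have swap: "c j = Green \<longleftrightarrow> d j = Red" if "j < N" for j
      using eq[OF that] ne by (metis color.distinct(1) color.exhaust)
    have swap': "c j = Red \<longleftrightarrow> d j = Green" if "j < N" for j
      using swap[OF that] by (metis color.distinct(1) color.exhaust)
    have "{j. j < N \<and> c j = Green} = {j. j < N \<and> d j = Red}"
      "{j. j < N \<and> c j = Red} = {j. j < N \<and> d j = Green}"
      using swap swap' by auto
    with c d show False by (simp add: p_equal_def red_green_coloring_def)
  qed
  with eq[OF i] show ?thesis by (metis color.exhaust)
qed

lemma solves_within_exists:
  assumes "N > 0"
  shows "\<exists>k t. solves_within N p k t"
proof -
  define same where "same c = {i. 1 \<le> i \<and> i \<le> N - 1 \<and> c i = c 0}" for c :: coloring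
  define f where "f S = (SOME c. p_equal N p c \<and> same c = S)" for S
  have "solves_within N p (N - 1) (compare_all (N - 1) f {})"
    unfolding solves_within_def
  proof (intro conjI allI impI)
    show "valid_strategy N (compare_all (N - 1) f {})"
      using assms by (intro valid_compare_all) simp
    fix c assume c: "p_equal N p c"
    show "comparisons (compare_all (N - 1) f {}) c \<le> N - 1"
      by (simp add: comparisons_compare_all)
    fix i assume i: "i < N"
    have an: "announced (compare_all (N - 1) f {}) c = f (same c)"
      unfolding announced_compare_all same_def by simp
    have "p_equal N p (f (same c)) \<and> same (f (same c)) = same c"
      unfolding f_def by (rule someI[of _ c]) (simp add: c)
    with p_equal_determined[of N p "f (same c)" c i] c assms i
    show "announced (compare_all (N - 1) f {}) c i = c i"
      unfolding an same_def by blast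
  qed
  then show ?thesis by blast
qed

lemma p_equal_exists:
  assumes "2 * p < N"
  shows "\<exists>c. p_equal N p c"
proof -
  let ?c = "\<lambda>i. if i < p then Green else Red"
  have "{i. i < N \<and> ?c i = Green} = {..<p}" "{i. i < N \<and> ?c i = Red} = {p..<N}"
    using assms by (auto split: if_splits)
  then have "p_equal N p ?c"
    using assms by (simp add: p_equal_def red_green_coloring_def)
  then show ?thesis by blast
qed

end

theory Submission
  imports Defs "HOL-Library.Multiset"
begin

text \<open>
  A comparison of two balls whose relative colors are unknown merges two blocks of balls into one,
  so a method does well if it stops with many blocks left. Comparing the first few balls
  with each other produces, at bounded cost, a ball known to be red. From then on an answer
  ``different'' is harmless: one more comparison with the red ball tells which of the two blocks
  is green, and since there are three green balls this happens at most three times. Up to an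
  additive constant, the method therefore faces an adversary in the following game. There are
  blocks of equal balls, and \<open>g\<close> balls in them are green. Two blocks of sizes \<open>a\<close>
  and \<open>b\<close> are merged, and either they have the same color and form a block of size
  \<open>a + b\<close>, or one of them is green and \<open>g\<close> drops by its size. A block larger than
  \<open>g\<close> is red and needs no further attention.

  Let \<open>x\<close>, \<open>y\<close> and \<open>z\<close> be the numbers of blocks of size 1, 2 and 3, and
  disregard additive constants.

  \<^item> If \<open>g = 1\<close>, pairing up the single balls costs \<open>x / 2\<close>.

  \<^item> If \<open>g = 2\<close>, merging a single ball with a pair gives a red block. Single balls in excess
    are grouped by three and pairs in excess are merged by two. The cost is the maximum of
    \<open>(2 * x + y) / 3\<close> and \<open>(x + y) / 2\<close> (\<open>win_two_green\<close>).

  \<^item> If \<open>g = 3\<close> and there are \<open>5 * s\<close> single balls, form \<open>2 * s\<close> pairs, which leaves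
    \<open>s\<close> single balls, and merge each of these with a pair. This leaves \<open>s\<close> pairs and \<open>s\<close>
    blocks of size 3. Now the pairs are red because of parity: a green pair would leave
    a single green ball, and no block has size 1. It remains to merge the blocks of size 3 by two. The
    cost is \<open>2 * s + s + s / 2\<close>, that is, seven tenths of the number of balls, which saves three
    tenths. The steps are \<open>win_three_green_pairing\<close>, \<open>win_three_green_pairs\<close> and
    \<open>win_three_green_no_single\<close>.

  If the adversary answers ``different'' while \<open>y\<close> pairs have been formed, the position with
  \<open>g = 2\<close> costs at most as much as what was left to pay for \<open>g = 3\<close>; at the end of the pairing, for
  \<open>y = 2 * s\<close>, the two costs are equal. This is what fixes the number of pairs.
\<close>

section \<open>Solving a set of colorings\<close>

definition solvable :: "nat \<Rightarrow> nat \<Rightarrow> coloring set \<Rightarrow> bool" where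
  "solvable N k C \<longleftrightarrow> (\<exists>t. valid_strategy N t \<and>
     (\<forall>c\<in>C. (\<forall>i<N. announced t c i = c i) \<and> comparisons t c \<le> k))"

lemma solvable_mono: "solvable N k C \<Longrightarrow> D \<subseteq> C \<Longrightarrow> k \<le> l \<Longrightarrow> solvable N l D"
  unfolding solvable_def by (meson order_trans subsetD)

lemma solvable_unique:
  assumes "\<And>c d i. c \<in> C \<Longrightarrow> d \<in> C \<Longrightarrow> i < N \<Longrightarrow> c i = d i"
  shows "solvable N k C"
proof (cases "C = {}")
  case True
  then show ?thesis
    unfolding solvable_def by (intro exI[of _ "Announce (\<lambda>_. Red)"]) simp
next
  case False
  then obtain c where "c \<in> C" by blast
  with assms show ?thesis
    unfolding solvable_def by (intro exI[of _ "Announce c"]) simp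
qed

lemma solvable_empty: "solvable N k {}"
  by (rule solvable_unique) auto

text \<open>The balls may coincide here, although a strategy has to compare distinct balls: the answer
  is then known in advance. So representatives of blocks need not be tracked as distinct.\<close>

lemma solvable_compare:
  assumes "i < N" "j < N"
    and same: "solvable N k {c \<in> C. c i = c j}"
    and diff: "solvable N k {c \<in> C. c i \<noteq> c j}"
  shows "solvable N (Suc k) C"
proof (cases "i = j")
  case True
  with same show ?thesis by (auto intro: solvable_mono)
next
  case False
  from same diff obtain s d where
    "valid_strategy N s" "\<forall>c\<in>{c \<in> C. c i = c j}. (\<forall>i<N. announced s c i = c i) \<and> comparisons s c \<le> k"
    "valid_strategy N d" "\<forall>c\<in>{c \<in> C. c i \<noteq> c j}. (\<forall>i<N. announced d c i = c i) \<and> comparisons d c \<le> k"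
    unfolding solvable_def by blast
  with False assms(1,2) show ?thesis
    unfolding solvable_def by (intro exI[of _ "Compare i j s d"]) auto
qed

lemma solvable_compare_with_0:
  assumes "\<And>D. D \<subseteq> C \<Longrightarrow> (\<And>c d i. c \<in> D \<Longrightarrow> d \<in> D \<Longrightarrow> i \<le> n \<Longrightarrow> (c i = c 0) = (d i = d 0))
      \<Longrightarrow> solvable N k D"
    and "n < N"
  shows "solvable N (k + n) C"
  using assms
proof (induction n arbitrary: k)
  case 0
  then show ?case by simp
next
  case (Suc n)
  have "solvable N (Suc k + n) C"
  proof (rule Suc.IH)
    fix D assume "D \<subseteq> C"
      and D: "\<And>c d i. c \<in> D \<Longrightarrow> d \<in> D \<Longrightarrow> i \<le> n \<Longrightarrow> (c i = c 0) = (d i = d 0)"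
    have "solvable N k {c \<in> D. (c (Suc n) = c 0) = same}" for same
    proof (rule Suc.prems(1))
      show "(c i = c 0) = (d i = d 0)"
        if "c \<in> {c \<in> D. (c (Suc n) = c 0) = same}" "d \<in> {c \<in> D. (c (Suc n) = c 0) = same}"
          "i \<le> Suc n" for c d i
        using that D[of c d i] by (cases "i = Suc n") (auto simp: le_Suc_eq)
    qed (use \<open>D \<subseteq> C\<close> in auto)
    from this[of True] this[of False] show "solvable N (Suc k) D"
      using Suc.prems(2) by (intro solvable_compare[of "Suc n" _ 0]) auto
  qed (use Suc.prems(2) in auto)
  then show ?case by simp
qed

section \<open>The game on block sizes\<close>

definition green_weight :: "coloring \<Rightarrow> (nat \<times> nat) multiset \<Rightarrow> nat" where
  "green_weight c B = (\<Sum>b\<in>#B. if c (fst b) = Green then snd b else 0)"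

lemma green_weight_simps [simp]:
  "green_weight c {#} = 0"
  "green_weight c (add_mset b B) = (if c (fst b) = Green then snd b else 0) + green_weight c B"
  by (simp_all add: green_weight_def)

lemma green_weight_subset_sum: "\<exists>M. M \<subseteq># image_mset snd B \<and> green_weight c B = \<Sum>\<^sub># M"
proof (induction B)
  case (add b B)
  then obtain M where M: "M \<subseteq># image_mset snd B" "green_weight c B = \<Sum>\<^sub># M" by blast
  show ?case
  proof (cases "c (fst b) = Green")
    case True
    with M show ?thesis by (intro exI[of _ "add_mset (snd b) M"]) simp
  next
    case False
    have "image_mset snd B \<subseteq># image_mset snd (add_mset b B)"
      by (simp add: subset_mset.less_imp_le)
    with M(1) have "M \<subseteq># image_mset snd (add_mset b B)"
      by (rule subset_mset.order_trans)
    with M(2) False show ?thesis by (intro exI[of _ M]) simp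
  qed
qed simp

text \<open>An undecided block is given by one of its balls and by its size. All other balls have colors
  that are known, or that follow from the colors of the blocks. Only the consequence is recorded, namely
  that a possible coloring is determined by its values on the representatives.\<close>

definition position :: "nat \<Rightarrow> nat \<Rightarrow> nat \<Rightarrow> (nat \<times> nat) multiset \<Rightarrow> coloring set \<Rightarrow> bool" where
  "position N r g B C \<longleftrightarrow> r < N \<and> (\<forall>b\<in>#B. fst b < N) \<and>
     (\<forall>c\<in>C. c r = Red \<and> green_weight c B = g) \<and>
     (\<forall>c\<in>C. \<forall>d\<in>C. (\<forall>b\<in>#B. c (fst b) = d (fst b)) \<longrightarrow> (\<forall>i<N. c i = d i))"

text \<open>This reduces the problem to the game: neither the identity of the representatives nor the
  set of possible colorings matters, only the sizes of the blocks and the number of green balls in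
  them.\<close>

definition win :: "nat \<Rightarrow> nat \<Rightarrow> nat multiset \<Rightarrow> nat \<Rightarrow> bool" where
  "win N g W k \<longleftrightarrow> (\<forall>r B C. position N r g B C \<and> image_mset snd B = W \<longrightarrow> solvable N k C)"

lemma winI:
  "(\<And>r B C. position N r g B C \<Longrightarrow> image_mset snd B = W \<Longrightarrow> solvable N k C) \<Longrightarrow> win N g W k"
  unfolding win_def by blast

lemma winD: "win N g W k \<Longrightarrow> position N r g B C \<Longrightarrow> image_mset snd B = W \<Longrightarrow> solvable N k C"
  unfolding win_def by blast

lemma win_no_blocks: "win N g {#} k"
  by (rule winI, rule solvable_unique) (auto simp: position_def)

lemma positionD:
  assumes "position N r g B C"
  shows "r < N" "b \<in># B \<Longrightarrow> fst b < N" "c \<in> C \<Longrightarrow> c r = Red" "c \<in> C \<Longrightarrow> green_weight c B = g"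
    "c \<in> C \<Longrightarrow> d \<in> C \<Longrightarrow> (\<And>b. b \<in># B \<Longrightarrow> c (fst b) = d (fst b)) \<Longrightarrow> i < N \<Longrightarrow> c i = d i"
  using assms unfolding position_def by blast+

lemma positionI:
  assumes "r < N" "\<And>b. b \<in># B \<Longrightarrow> fst b < N" "\<And>c. c \<in> C \<Longrightarrow> c r = Red"
    "\<And>c. c \<in> C \<Longrightarrow> green_weight c B = g"
    "\<And>c d i. c \<in> C \<Longrightarrow> d \<in> C \<Longrightarrow> (\<And>b. b \<in># B \<Longrightarrow> c (fst b) = d (fst b)) \<Longrightarrow> i < N \<Longrightarrow> c i = d i"
  shows "position N r g B C"
  using assms unfolding position_def by blast

lemma position_block_decided:
  assumes pos: "position N r g (add_mset (x, a) B) C" and "D \<subseteq> C" and D: "\<And>c. c \<in> D \<Longrightarrow> c x = col"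
  shows "position N r (g - (if col = Green then a else 0)) B D"
proof (rule positionI)
  show "c i = d i" if "c \<in> D" "d \<in> D"
    and eq: "\<And>b. b \<in># B \<Longrightarrow> c (fst b) = d (fst b)" and "i < N" for c d i
  proof (rule positionD(5)[OF pos])
    show "c (fst b) = d (fst b)" if "b \<in># add_mset (x, a) B" for b
      using that eq[of b] D[OF \<open>c \<in> D\<close>] D[OF \<open>d \<in> D\<close>] by auto
  qed (use that \<open>D \<subseteq> C\<close> in auto)
  show "green_weight c B = g - (if col = Green then a else 0)" if "c \<in> D" for c
    using positionD(4)[OF pos, of c] D[OF that] that \<open>D \<subseteq> C\<close> by auto
qed (use positionD(1-3)[OF pos] \<open>D \<subseteq> C\<close> in auto)

lemma position_block_red:
  assumes "position N r g (add_mset (x, a) B) C" "D \<subseteq> C" "\<And>c. c \<in> D \<Longrightarrow> c x = Red"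
  shows "position N r g B D"
  using position_block_decided[OF assms(1,2), of Red] assms(3) by simp

lemma position_block_green:
  assumes "position N r g (add_mset (x, a) B) C" "D \<subseteq> C" "\<And>c. c \<in> D \<Longrightarrow> c x = Green"
  shows "position N r (g - a) B D"
  using position_block_decided[OF assms(1,2), of Green] assms(3) by simp

lemma position_block_merged:
  assumes pos: "position N r g (add_mset (x, a) (add_mset (y, b) B)) C" and "D \<subseteq> C"
    and D: "\<And>c. c \<in> D \<Longrightarrow> c x = c y"
  shows "position N r g (add_mset (x, a + b) B) D"
proof (rule positionI)
  show "c i = d i" if "c \<in> D" "d \<in> D"
    and eq: "\<And>e. e \<in># add_mset (x, a + b) B \<Longrightarrow> c (fst e) = d (fst e)" and "i < N" for c d i
  proof (rule positionD(5)[OF pos])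
    show "c (fst e) = d (fst e)" if "e \<in># add_mset (x, a) (add_mset (y, b) B)" for e
      using that eq[of e] eq[of "(x, a + b)"] D[OF \<open>c \<in> D\<close>] D[OF \<open>d \<in> D\<close>] by auto
  qed (use that \<open>D \<subseteq> C\<close> in auto)
  show "green_weight c (add_mset (x, a + b) B) = g" if "c \<in> D" for c
    using positionD(4)[OF pos, of c] D[OF that] that \<open>D \<subseteq> C\<close> by (auto split: if_splits)
  show "fst e < N" if "e \<in># add_mset (x, a + b) B" for e
    using that positionD(2)[OF pos, of e] positionD(2)[OF pos, of "(x, a)"] by auto
qed (use positionD(1,3)[OF pos] \<open>D \<subseteq> C\<close> in auto)

lemma position_green_le:
  assumes "position N r g (add_mset (x, a) B) C" "c \<in> C" "c x = Green"
  shows "a \<le> g"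
  using positionD(4)[OF assms(1,2)] assms(3) by simp

text \<open>If a block were green, the sizes of the other green blocks would add up to \<open>g - a\<close>. Where this
  is impossible the block is red. Both blocks that are too large and the parity
  argument are instances.\<close>

lemma win_drop:
  assumes "\<And>M. M \<subseteq># W \<Longrightarrow> a + \<Sum>\<^sub># M \<noteq> g" and "win N g W k"
  shows "win N g (add_mset a W) k"
proof (rule winI)
  fix r B' C assume pos: "position N r g B' C" and "image_mset snd B' = add_mset a W"
  then obtain x B where B': "B' = add_mset (x, a) B" and W: "image_mset snd B = W"
    by (metis msed_map_invR prod.collapse)
  have "c x = Red" if "c \<in> C" for c
  proof (rule ccontr)
    assume "c x \<noteq> Red"
    then have "c x = Green" using color.exhaust by blast
    with positionD(4)[OF pos that] B' have "a + green_weight c B = g" by simp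
    with green_weight_subset_sum[of B c] W assms(1) show False by metis
  qed
  with pos B' have "position N r g B C" by (blast intro: position_block_red)
  with assms(2) W show "solvable N k C" by (blast intro: winD)
qed

lemma win_all_red: "0 \<notin># W \<Longrightarrow> win N 0 W k"
proof (induction W)
  case (add a W)
  then show ?case by (intro win_drop) auto
qed (rule win_no_blocks)

lemma win_drop_large: "g < a \<Longrightarrow> win N g W k \<Longrightarrow> win N g (add_mset a W) k"
  by (intro win_drop) auto

lemma win_reveal:
  assumes "win N g W k" and "a \<le> g \<Longrightarrow> win N (g - a) W k"
  shows "win N g (add_mset a W) (Suc k)"
proof (rule winI)
  fix r B' C assume pos: "position N r g B' C" and "image_mset snd B' = add_mset a W"
  then obtain x B where B': "B' = add_mset (x, a) B" and W: "image_mset snd B = W"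
    by (metis msed_map_invR prod.collapse)
  have r: "c r = Red" if "c \<in> C" for c using pos that by (rule positionD(3))
  show "solvable N (Suc k) C"
  proof (rule solvable_compare[of x _ r])
    have "position N r g B {c \<in> C. c x = c r}"
      using pos unfolding B' by (rule position_block_red) (auto simp: r)
    with assms(1) W show "solvable N k {c \<in> C. c x = c r}" by (blast intro: winD)
    have green: "c x = Green" if "c \<in> {c \<in> C. c x \<noteq> c r}" for c
      using that r[of c] by (cases "c x") auto
    show "solvable N k {c \<in> C. c x \<noteq> c r}"
    proof (cases "{c \<in> C. c x \<noteq> c r} = {}")
      case True
      then show ?thesis by (simp only: solvable_empty)
    next
      case False
      then obtain c where "c \<in> {c \<in> C. c x \<noteq> c r}" by blast
      with green[OF this] position_green_le[OF pos[unfolded B'], of c] have "a \<le> g" by simp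
      moreover have "position N r (g - a) B {c \<in> C. c x \<noteq> c r}"
        using pos[unfolded B'] _ green by (rule position_block_green) auto
      ultimately show ?thesis using assms(2) W by (blast intro: winD)
    qed
  qed (use positionD(1)[OF pos] positionD(2)[OF pos, of "(x, a)"] B' in auto)
qed

text \<open>After the answer ``different'' the first block is compared with the red reference ball,
  which decides both blocks.\<close>

lemma win_merge:
  assumes k: "2 \<le> k" and m: "m = a + b"
    and same: "win N g (add_mset m W) (k - 1)"
    and green_a: "a \<le> g \<Longrightarrow> win N (g - a) W (k - 2)"
    and green_b: "b \<le> g \<Longrightarrow> win N (g - b) W (k - 2)"
  shows "win N g (add_mset a (add_mset b W)) k"
proof (rule winI)
  fix r B' C assume pos: "position N r g B' C" and "image_mset snd B' = add_mset a (add_mset b W)"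
  then obtain x B1 where B1: "B' = add_mset (x, a) B1" "image_mset snd B1 = add_mset b W"
    by (metis msed_map_invR prod.collapse)
  then obtain y B where "B1 = add_mset (y, b) B" and W: "image_mset snd B = W"
    by (metis msed_map_invR prod.collapse)
  with B1 have B': "B' = add_mset (x, a) (add_mset (y, b) B)" by simp
  have r: "c r = Red" if "c \<in> C" for c using pos that by (rule positionD(3))
  have lt: "x < N" "y < N" "r < N"
    using positionD(1)[OF pos] positionD(2)[OF pos, of "(x, a)"] positionD(2)[OF pos, of "(y, b)"] B' by auto
  have decided: "solvable N (k - 2) D"
    if pos: "position N r g (add_mset (u, p) (add_mset (v, q) B)) C"
      and D: "D \<subseteq> C" "\<And>c. c \<in> D \<Longrightarrow> c u = Green \<and> c v = Red"
      and win: "p \<le> g \<Longrightarrow> win N (g - p) W (k - 2)" for u v p q D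
  proof (cases "D = {}")
    case False
    then obtain c where "c \<in> D" by blast
    with D position_green_le[OF pos, of c] have "p \<le> g" by blast
    have "position N r (g - p) (add_mset (v, q) B) D"
      by (rule position_block_green[OF pos D(1)]) (simp add: D(2))
    then have "position N r (g - p) B D"
      by (rule position_block_red) (simp_all add: D(2))
    with win \<open>p \<le> g\<close> W show ?thesis by (blast intro: winD)
  qed (simp add: solvable_empty)
  have "solvable N (Suc (k - 1)) C"
  proof (rule solvable_compare[of x _ y])
    have "position N r g (add_mset (x, m) B) {c \<in> C. c x = c y}"
      using pos unfolding B' m by (rule position_block_merged) auto
    with same W show "solvable N (k - 1) {c \<in> C. c x = c y}" by (auto intro: winD)
    have "solvable N (Suc (k - 2)) {c \<in> C. c x \<noteq> c y}"
    proof (rule solvable_compare[of x _ r])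
      have "position N r g (add_mset (y, b) (add_mset (x, a) B)) C"
        using pos by (simp add: B' add_mset_commute)
      then show "solvable N (k - 2) {c \<in> {c \<in> C. c x \<noteq> c y}. c x = c r}"
      proof (rule decided)
        show "c y = Green \<and> c x = Red" if "c \<in> {c \<in> {c \<in> C. c x \<noteq> c y}. c x = c r}" for c
          using that r[of c] by (cases "c y") auto
      qed (use green_b in auto)
      from pos show "solvable N (k - 2) {c \<in> {c \<in> C. c x \<noteq> c y}. c x \<noteq> c r}"
        unfolding B'
      proof (rule decided)
        show "c x = Green \<and> c y = Red" if "c \<in> {c \<in> {c \<in> C. c x \<noteq> c y}. c x \<noteq> c r}" for c
          using that r[of c] by (cases "c x"; cases "c y") auto
      qed (use green_a in auto)
    qed (use lt in auto)
    moreover have "Suc (k - 2) = k - 1" using k by simp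
    ultimately show "solvable N (k - 1) {c \<in> C. c x \<noteq> c y}" by (simp only:)
  qed (use lt in auto)
  then show "solvable N k C" using k by simp
qed

section \<open>Playing the game\<close>

definition blocks :: "nat \<Rightarrow> nat \<Rightarrow> nat \<Rightarrow> nat multiset" where
  "blocks x y z = replicate_mset x 1 + replicate_mset y 2 + replicate_mset z 3"

lemma blocks_0 [simp]: "blocks 0 0 0 = {#}"
  by (simp add: blocks_def)

lemma blocks_Suc:
  "blocks (Suc x) y z = add_mset 1 (blocks x y z)"
  "blocks x (Suc y) z = add_mset 2 (blocks x y z)"
  "blocks x y (Suc z) = add_mset 3 (blocks x y z)"
  by (simp_all add: blocks_def)

lemma win_all_red_blocks: "win N 0 (blocks x y z) k"
  by (rule win_all_red) (simp add: blocks_def)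

lemma win_drop_3:
  assumes "g < 3" "win N g (blocks x y 0) k"
  shows "win N g (blocks x y z) k"
  using assms by (induction z) (simp_all add: blocks_Suc(3) win_drop_large)

lemma win_drop_2:
  assumes "g < 2" "win N g (blocks x 0 z) k"
  shows "win N g (blocks x y z) k"
  using assms by (induction y) (simp_all add: blocks_Suc(2) win_drop_large)

lemma win_merge_1_1:
  assumes "2 \<le> k" "win N g (blocks x (Suc y) z) (k - 1)" "win N (g - 1) (blocks x y z) (k - 2)"
  shows "win N g (blocks (Suc (Suc x)) y z) k"
  unfolding blocks_Suc(1)
  by (rule win_merge[where m = 2]) (use assms in \<open>simp_all only: blocks_Suc(2) one_add_one\<close>)

lemma win_merge_1_2:
  assumes "2 \<le> k" "win N g (blocks x y (Suc z)) (k - 1)"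
    and "win N (g - 1) (blocks x y z) (k - 2)" "win N (g - 2) (blocks x y z) (k - 2)"
  shows "win N g (blocks (Suc x) (Suc y) z) k"
  unfolding blocks_Suc(1,2)
  by (rule win_merge[where m = 3]) (use assms in \<open>simp_all add: blocks_Suc(3)\<close>)

text \<open>Two blocks whose size is the number of green balls: either their union is too large to be
  green, or one of them contains all green balls.\<close>

lemma win_merge_full:
  assumes "0 < g" "2 \<le> k" "win N g W (k - 1)" "win N 0 W (k - 2)"
  shows "win N g (add_mset g (add_mset g W)) k"
  by (rule win_merge[OF assms(2) refl]) (use assms in \<open>simp_all add: win_drop_large\<close>)

lemma win_reveal_full:
  assumes "0 < g" "1 \<le> k" "win N g W (k - 1)" "win N 0 W (k - 1)"
  shows "win N g (add_mset g W) k"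
  using win_reveal[of N g W "k - 1" g] assms by simp

lemma win_full_blocks:
  assumes "0 < g" and "n + 2 \<le> 2 * k"
  shows "win N g (replicate_mset n g) k"
  using assms(2)
proof (induction n arbitrary: k rule: induct_nat_012)
  case 0
  then show ?case by (simp add: win_no_blocks)
next
  case 1
  then have "win N g (add_mset g {#}) k"
    using assms(1) by (intro win_reveal_full win_no_blocks) auto
  then show ?case by simp
next
  case (ge2 n)
  have "win N g (replicate_mset n g) (k - 1)" using ge2.prems by (intro ge2.IH(1)) simp
  moreover have "win N 0 (replicate_mset n g) (k - 2)" using assms(1) by (intro win_all_red) simp
  ultimately have "win N g (add_mset g (add_mset g (replicate_mset n g))) k"
    using ge2.prems assms(1) by (intro win_merge_full) simp_all
  then show ?case by simp
qed

lemma win_one_green: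
  assumes "x + 2 \<le> 2 * k"
  shows "win N 1 (blocks x y z) k"
proof (rule win_drop_3)
  have "win N 1 (blocks x 0 0) k" using win_full_blocks[of 1 x k N] assms by (simp add: blocks_def)
  then show "win N 1 (blocks x y 0) k" by (rule win_drop_2[rotated]) simp
qed simp

text \<open>The two terms of the cost are the price of merging triples of single balls and of merging
  pairs by two. A merge of a single ball with a pair lowers both by exactly one comparison. When there are no
  pairs, the first term dominates, and it allows for one comparison to form a pair.\<close>

lemma win_two_green:
  assumes "4 * x + 2 * y + 18 \<le> 6 * k" "3 * x + 3 * y + 18 \<le> 6 * k"
  shows "win N 2 (blocks x y z) k"
  using assms
proof (induction "x + y" arbitrary: x y z k rule: less_induct)
  case less
  have "x = 0 \<or> y = 0 \<and> x = 1 \<or> y = 0 \<and> 2 \<le> x \<or> 1 \<le> x \<and> 1 \<le> y" by arith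
  then consider "x = 0" | "y = 0" "x = 1" | "y = 0" "2 \<le> x" | "1 \<le> x" "1 \<le> y" by blast
  then show ?case
  proof cases
    case 1
    have "win N 2 (blocks 0 y 0) k"
      using less.prems 1 win_full_blocks[of 2 y k N] by (simp add: blocks_def)
    then show ?thesis unfolding 1 by (rule win_drop_3[rotated]) simp
  next
    case 2
    have "win N 2 (add_mset 1 {#}) (Suc (k - 1))"
      by (rule win_reveal) (rule win_no_blocks)+
    then have "win N 2 (blocks 1 0 0) k"
      using less.prems by (simp add: blocks_def)
    then show ?thesis unfolding 2 by (rule win_drop_3[rotated]) simp
  next
    case 3
    define x' where "x' = x - 2"
    have x: "x = Suc (Suc x')" using 3 by (simp add: x'_def)
    have "4 * x' + 26 \<le> 6 * k" using less.prems(1) 3 x by simp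
    \<comment> \<open>For \<open>x' = 0\<close> this holds because \<open>k\<close> is an integer.\<close>
    then have "3 * x' + 27 \<le> 6 * k" by (cases "x' = 0"; cases "k \<le> 4") simp_all
    then have "win N 2 (blocks x' (Suc 0) z) (k - 1)"
      using less.prems 3 x by (intro less.hyps) auto
    moreover have "win N (2 - 1) (blocks x' 0 z) (k - 2)"
      using less.prems x win_one_green[of x' "k - 2" N 0 z] by simp
    ultimately show ?thesis
      unfolding x 3(1) using less.prems by (intro win_merge_1_1) auto
  next
    case 4
    define x' y' where "x' = x - 1" and "y' = y - 1"
    have xy: "x = Suc x'" "y = Suc y'" using 4 by (simp_all add: x'_def y'_def)
    have "win N 2 (blocks x' y' (Suc z)) (k - 1)"
      using less.prems xy by (intro less.hyps) auto
    moreover have "win N (2 - 1) (blocks x' y' z) (k - 2)"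
      using less.prems xy win_one_green[of x' "k - 2" N y' z] by simp
    moreover have "win N (2 - 2) (blocks x' y' z) (k - 2)"
      by (simp add: win_all_red_blocks)
    ultimately show ?thesis
      unfolding xy using less.prems by (intro win_merge_1_2) auto
  qed
qed

text \<open>This is the parity argument: a green pair would leave one green ball to be accounted
  for by blocks of size at least 2.\<close>

lemma win_three_green_no_single:
  assumes "z + 2 \<le> 2 * k"
  shows "win N 3 (blocks 0 y z) k"
proof (induction y)
  case 0
  show ?case using win_full_blocks[of 3 z k N] assms by (simp add: blocks_def)
next
  case (Suc y)
  have "win N 3 (add_mset 2 (blocks 0 y z)) k"
  proof (rule win_drop)
    fix M assume M: "M \<subseteq># blocks 0 y z"
    show "2 + \<Sum>\<^sub># M \<noteq> 3"
    proof (cases M)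
      case (add m M')
      with M have "m \<in># blocks 0 y z" by (auto dest: mset_subset_eqD)
      then have "2 \<le> m" by (auto simp: blocks_def split: if_splits)
      with add show ?thesis by simp
    qed simp
  qed (rule Suc.IH)
  then show ?case by (simp only: blocks_Suc(2))
qed

text \<open>The second bound on the budget is the cost of a position with two green balls and the same
  numbers of single balls and pairs. A merge of a single ball with a pair lowers both
  bounds by one comparison.\<close>

lemma win_three_green_pairs:
  assumes "x \<le> y" "3 * x + z + 2 \<le> 2 * k" "x + y + 8 \<le> 2 * k"
  shows "win N 3 (blocks x y z) k"
  using assms
proof (induction x arbitrary: y z k)
  case 0
  then show ?case by (intro win_three_green_no_single) simp
next
  case (Suc x)
  then obtain y' where y: "y = Suc y'" by (metis Suc_le_D)
  have "win N 3 (blocks x y' (Suc z)) (k - 1)"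
    using Suc.prems y by (intro Suc.IH) auto
  moreover have "win N (3 - 1) (blocks x y' z) (k - 2)"
    using Suc.prems y win_two_green[of x y' "k - 2" N z] by simp
  moreover have "win N (3 - 2) (blocks x y' z) (k - 2)"
    using Suc.prems y win_one_green[of x "k - 2" N y' z] by simp
  ultimately show ?case
    unfolding y using Suc.prems by (intro win_merge_1_2) auto
qed

text \<open>Here \<open>n\<close> pairs are still to be formed. If the next one turns out to be of
  different colors, two green balls remain, and grouping the rest costs about \<open>(3 * s + n) / 2\<close> or
  \<open>(4 * s + 3 * n) / 3\<close>, while \<open>(3 * s + 2 * n) / 2\<close> comparisons are available. The first of these costs
  uses up the budget for \<open>n = 0\<close>, which is why no further pair is formed then.\<close>

lemma win_three_green_pairing:
  assumes "n \<le> 2 * s" "2 * n + 3 * s + 8 \<le> 2 * k"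
  shows "win N 3 (blocks (s + 2 * n) (2 * s - n) 0) k"
  using assms
proof (induction n arbitrary: k)
  case 0
  then show ?case by (simp add: win_three_green_pairs)
next
  case (Suc n)
  have "win N 3 (blocks (s + 2 * n) (Suc (2 * s - Suc n)) 0) (k - 1)"
    using Suc.IH[of "k - 1"] Suc.prems by (simp add: Suc_diff_Suc)
  moreover have "win N (3 - 1) (blocks (s + 2 * n) (2 * s - Suc n) 0) (k - 2)"
    using Suc.prems win_two_green[of "s + 2 * n" "2 * s - Suc n" "k - 2" N 0] by simp
  ultimately have "win N 3 (blocks (Suc (Suc (s + 2 * n))) (2 * s - Suc n) 0) k"
    using Suc.prems by (intro win_merge_1_1) auto
  then show ?case by simp
qed

lemma win_at_most_three_green:
  assumes "g \<le> 3" "7 * s + 8 \<le> 2 * k"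
  shows "win N g (replicate_mset (5 * s) 1) k"
proof -
  consider "g = 0" | "g = 1" | "g = 2" | "g = 3" using assms(1) by linarith
  then have "win N g (blocks (5 * s) 0 0) k"
  proof cases
    case 1
    then show ?thesis by (simp add: win_all_red_blocks)
  next
    case 2
    with win_one_green[of "5 * s" k N 0 0] assms(2) show ?thesis by simp
  next
    case 3
    with win_two_green[of "5 * s" 0 k N 0] assms(2) show ?thesis by simp
  next
    case 4
    with win_three_green_pairing[of "2 * s" s k N] assms(2) show ?thesis by simp
  qed
  then show ?thesis by (simp add: blocks_def)
qed

section \<open>Finding a red ball\<close>

text \<open>The balls from \<open>1\<close> to \<open>n\<close> are compared with ball \<open>0\<close>. At least seven balls are needed in order that
  the three green ones cannot be a majority. All these balls are then decided, so their number can be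
  chosen to make the number of the other balls divisible by five.\<close>

lemma three_green_solvable:
  assumes N: "N = 5 * s + Suc n" and n: "6 \<le> n" and k: "7 * s + 8 \<le> 2 * k"
  shows "solvable N (k + n) {c. p_equal N 3 c}"
proof (rule solvable_compare_with_0)
  fix D assume D3: "D \<subseteq> {c. p_equal N 3 c}"
    and D: "\<And>c d i. c \<in> D \<Longrightarrow> d \<in> D \<Longrightarrow> i \<le> n \<Longrightarrow> (c i = c 0) = (d i = d 0)"
  define G where "G c = {i. i < N \<and> c i = Green}" for c :: coloring
  have G: "card (G c) = 3" "finite (G c)" if "c \<in> D" for c
    using D3 that by (auto simp: G_def p_equal_def)
  \<comment> \<open>Colorings that differ at \<open>0\<close> are opposite on at least seven balls, and all of these are green
    in one of the two colorings.\<close>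
  have same_0: "c 0 = d 0" if "c \<in> D" "d \<in> D" for c d
  proof (rule ccontr)
    assume ne: "c 0 \<noteq> d 0"
    have "{..n} \<subseteq> G c \<union> G d"
    proof
      fix i assume "i \<in> {..n}"
      with D[OF that, of i] ne have "c i \<noteq> d i"
        by (cases "c i"; cases "d i"; cases "c 0"; cases "d 0") auto
      then have "c i = Green \<or> d i = Green" by (cases "c i"; cases "d i") auto
      with \<open>i \<in> {..n}\<close> N show "i \<in> G c \<union> G d" by (auto simp: G_def)
    qed
    then have "card {..n} \<le> card (G c \<union> G d)" using that by (intro card_mono) (auto simp: G)
    also have "\<dots> \<le> 6" using card_Un_le[of "G c" "G d"] that by (simp add: G)
    finally show False using n by simp
  qed
  have known: "c i = d i" if "c \<in> D" "d \<in> D" "i \<le> n" for c d i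
    using D[OF that] same_0[OF that(1,2)] by (cases "c i"; cases "d i"; cases "d 0") auto
  show "solvable N k D"
  proof (cases "D = {}")
    case False
    then obtain e where e: "e \<in> D" by blast
    have "\<not> {..n} \<subseteq> G e"
      using card_mono[of "G e" "{..n}"] G[OF e] n by auto
    then obtain r where "r \<le> n" "r \<notin> G e" by auto
    then have r: "r \<le> n" "e r = Red"
      using N by (cases "e r"; simp add: G_def)+
    define g where "g = 3 - card (G e \<inter> {..n})"
    define B where "B = image_mset (\<lambda>i. (i, 1::nat)) (mset_set {n<..<N})"
    have "position N r g B D"
    proof (rule positionI)
      show "r < N" using r N by simp
      show "fst b < N" if "b \<in># B" for b using that by (auto simp: B_def)
      show "c r = Red" if "c \<in> D" for c using known[OF that e r(1)] r by simp
      show "green_weight c B = g" if c: "c \<in> D" for c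
      proof -
        have "green_weight c B = (\<Sum>i\<in>{n<..<N}. if c i = Green then 1 else 0)"
          by (simp add: green_weight_def B_def image_mset.compositionality comp_def sum_unfold_sum_mset
              cong: if_cong)
        also have "\<dots> = card ({n<..<N} \<inter> {i. c i = Green})"
          by (simp add: sum.If_cases)
        also have "{n<..<N} \<inter> {i. c i = Green} = G c - (G c \<inter> {..n})"
          by (auto simp: G_def)
        also have "G c \<inter> {..n} = G e \<inter> {..n}"
          using known[OF c e] by (auto simp: G_def)
        also have "card (G c - G e \<inter> {..n}) = 3 - card (G e \<inter> {..n})"
          using \<open>G c \<inter> {..n} = G e \<inter> {..n}\<close> G[OF c] by (subst card_Diff_subset) auto
        finally show ?thesis by (simp add: g_def)
      qed
      show "c i = d i" if "c \<in> D" "d \<in> D" "\<And>b. b \<in># B \<Longrightarrow> c (fst b) = d (fst b)" "i < N" for c d i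
        using that(1,2,4) that(3)[of "(i, 1)"] known[of c d i] by (cases "i \<le> n") (auto simp: B_def)
    qed
    moreover have "image_mset snd B = replicate_mset (5 * s) 1"
      using N by (simp add: B_def image_mset.compositionality comp_def image_mset_const_eq)
    moreover have "win N g (replicate_mset (5 * s) 1) k"
      using k by (intro win_at_most_three_green) (simp_all add: g_def)
    ultimately show ?thesis by (blast intro: winD)
  qed (simp add: solvable_empty)
qed (simp add: N)

theorem proposition4:
  "\<exists>D::real. D > 0 \<and> (\<forall>N::nat. N \<ge> 7 \<longrightarrow>
     real_of_int (B_eq N 3) \<ge> real_of_int \<lfloor>3 * real N / 10\<rfloor> - D)"
proof (intro exI[of _ "7::real"] conjI allI impI)
  fix N :: nat assume "7 \<le> N"
  define s n where "s = (N - 7) div 5" and "n = 6 + (N - 7) mod 5"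
  define k where "k = (7 * s + 9) div 2"
  have N: "N = 5 * s + Suc n" using \<open>7 \<le> N\<close> by (simp add: s_def n_def)
  have "solvable N (k + n) {c. p_equal N 3 c}"
    by (rule three_green_solvable[OF N]) (simp_all add: n_def k_def)
  then obtain t where "solves_within N 3 (k + n) t"
    unfolding solvable_def solves_within_def by auto
  then have "Q_eq N 3 \<le> k + n"
    unfolding Q_eq_def by (blast intro: Least_le)
  moreover have "2 * k \<le> 7 * s + 9" "n \<le> 10" by (simp_all add: k_def n_def)
  moreover have "real_of_int \<lfloor>3 * real N / 10\<rfloor> \<le> 3 * real N / 10"
    by (rule of_int_floor_le)
  ultimately show "real_of_int (B_eq N 3) \<ge> real_of_int \<lfloor>3 * real N / 10\<rfloor> - 7"
    unfolding B_eq_def N by simp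
qed simp

end
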